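(* Let $X$ be a Hausdorff topological space. Then $X$ has an open uniform (G) at non-isolated points if and only if $X$ is an open boundary-compact image of a metric space, i.e. there exist a metric space $M$ and a continuous surjective open boundary-compact map $f:M\to X$.
   Context: For a topological space $X$, $\tau(X)$ denotes its topology, $I(X)$ the set of isolated points of $X$, and $X^{d}=X\setminus I(X)$ the set of non-isolated points. A map $f:M\to X$ is boundary-compact if for each $x\in X$ the topological boundary $\partial f^{-1}(x)$ is compact in $M$. Open uniform (G) at non-isolated points: $X$ has one if there exists an assignment $\mathcal{W}=\{\mathcal{W}_{x}: x\in X\}$, where each $\mathcal{W}_x$ is a family of open subsets of $X$, such that: (1) for each $x\in X$, $x\in\bigcap\mathcal{W}_{x}$ and $|\mathcal{W}_{x}|\le\aleph_{0}$; (2) for each $x\in U\in\tau(X)$ there exists an open neighborhood $V(x,U)$ of $x$ such that for each $y\in V(x,U)\cap X^{d}$ there is a $W\in\mathcal{W}_{y}$ with $x\in W\subset U$; (3) for each $x\in X$, every infinite subfamily $\mathcal{W}_{x}'\subset\mathcal{W}_{x}$ is a network at $x$ (i.e. for every open $U\ni x$ there is $W\in\mathcal{W}_x'$ with $x\in W\subset U$). *)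

theory Defs
  imports "HOL-Analysis.Analysis"
begin

definition isolated_points :: "'a topology \<Rightarrow> 'a set" where
  "isolated_points X = {x \<in> topspace X. openin X {x}}"

definition nonisolated_points :: "'a topology \<Rightarrow> 'a set" where
  "nonisolated_points X = topspace X - isolated_points X"

definition network_at :: "'a topology \<Rightarrow> 'a \<Rightarrow> 'a set set \<Rightarrow> bool" where
  "network_at X x \<N> \<longleftrightarrow> (\<forall>U. openin X U \<and> x \<in> U \<longrightarrow> (\<exists>W\<in>\<N>. x \<in> W \<and> W \<subseteq> U))"

definition open_uniform_G_assignment :: "'a topology \<Rightarrow> ('a \<Rightarrow> 'a set set) \<Rightarrow> bool" where
  "open_uniform_G_assignment X \<W> \<longleftrightarrow>
     (\<forall>x\<in>topspace X. \<forall>W\<in>\<W> x. openin X W) \<and>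
     (\<forall>x\<in>topspace X. x \<in> \<Inter>(\<W> x) \<and> countable (\<W> x)) \<and>
     (\<forall>x U. openin X U \<and> x \<in> U \<longrightarrow>
        (\<exists>V. openin X V \<and> x \<in> V \<and>
          (\<forall>y \<in> V \<inter> nonisolated_points X. \<exists>W\<in>\<W> y. x \<in> W \<and> W \<subseteq> U))) \<and>
     (\<forall>x\<in>topspace X. \<forall>\<W>'. \<W>' \<subseteq> \<W> x \<and> infinite \<W>' \<longrightarrow> network_at X x \<W>')"

definition has_open_uniform_G_at_nonisolated :: "'a topology \<Rightarrow> bool" where
  "has_open_uniform_G_at_nonisolated X \<longleftrightarrow> (\<exists>\<W>. open_uniform_G_assignment X \<W>)"

definition boundary_compact_map :: "'m topology \<Rightarrow> 'a topology \<Rightarrow> ('m \<Rightarrow> 'a) \<Rightarrow> bool" where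
  "boundary_compact_map M X f \<longleftrightarrow>
     (\<forall>x\<in>topspace X. compactin M (M frontier_of {z \<in> topspace M. f z = x}))"

definition open_boundary_compact_onto :: "'m topology \<Rightarrow> 'a topology \<Rightarrow> ('m \<Rightarrow> 'a) \<Rightarrow> bool" where
  "open_boundary_compact_onto M X f \<longleftrightarrow>
     continuous_map M X f \<and> f ` topspace M = topspace X \<and> open_map M X f \<and>
     boundary_compact_map M X f"

text \<open>HOL cannot quantify existentially over types, so ``there is a metric space M'' needs a
  carrier type in advance. The theorem takes M inside \<^typ>\<open>nat \<Rightarrow> 'a set\<close> for existence (sequences
  of subsets of the space), and lets M live in an arbitrary type for the converse.
  Note that \<^typ>\<open>'m metric\<close> carries its own underlying set \<^term>\<open>mspace\<close>, which may be any
  subset of the type (also empty).\<close>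

end

theory Submission
  imports Defs
begin

text \<open>If \<open>f\<close> is an open boundary-compact map from a metric space, the fibre of a non-isolated point \<open>y\<close>
  has empty interior, so it is compact and has a finite \<open>1/n\<close>-net \<open>D\<close> for every \<open>n\<close>; the images of the
  balls of radius \<open>2/n\<close> about the points of \<open>D\<close> form \<open>\<W> y\<close>.

  Conversely, build a tree of open sets in which a node is the list of centres leading to it. A child of
  a node \<open>S\<close> with centre \<open>y\<close> lies in a small neighbourhood of \<open>y\<close> that avoids all earlier centres
  other than \<open>y\<close>. This makes the members of \<open>\<W> x\<close> witnessing condition (2) along a branch around \<open>x\<close>
  take each value only finitely often unless the centres stabilise, so that the nodes of the branch form
  a network at \<open>x\<close>. Well-ordering the centres, the covering of \<open>S\<close> by such neighbourhoods has an
  open refinement which is point-finite at non-isolated points. The metric space consists of the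
  convergent branches; the fibre of a non-isolated point is the set of branches of a finitely
  branching tree.\<close>

section \<open>From an open boundary-compact map to an open uniform (G)\<close>

text \<open>An open set inside the fibre would have the open image \<open>{y}\<close>, so the
  interior is empty. Both directions use this to trade boundaries for fibres.\<close>

lemma fibre_eq_frontier:
  assumes X: "t1_space X" and f: "continuous_map M X f" "open_map M X f"
    and y: "y \<in> nonisolated_points X"
  shows "M frontier_of {z \<in> topspace M. f z = y} = {z \<in> topspace M. f z = y}" (is "_ frontier_of ?F = _")
proof -
  have yX: "y \<in> topspace X" "\<not> openin X {y}"
    using y by (auto simp: nonisolated_points_def isolated_points_def)
  have "closedin X {y}"
    using X yX by (simp add: closedin_t1_singleton)
  then have "closedin M {z \<in> topspace M. f z \<in> {y}}"
    using closedin_continuous_map_preimage[OF f(1)] by blast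
  then have closed: "closedin M ?F" by simp
  have "M interior_of ?F = {}"
  proof (rule ccontr)
    assume ne: "M interior_of ?F \<noteq> {}"
    have "M interior_of ?F \<subseteq> ?F" by (rule interior_of_subset)
    with ne have "f ` (M interior_of ?F) = {y}" by blast
    moreover have "openin X (f ` (M interior_of ?F))"
      using f(2) openin_interior_of unfolding open_map_def by blast
    ultimately show False using yX by simp
  qed
  with closed show ?thesis
    by (simp add: frontier_of_def closure_of_closedin)
qed

lemma open_boundary_compact_image_imp_open_uniform_G:
  fixes X :: "'a topology" and m :: "'m metric"
  assumes X: "t1_space X" and f: "open_boundary_compact_onto (mtopology_of m) X f"
  shows "has_open_uniform_G_at_nonisolated X"
proof -
  interpret Metric_space "mspace m" "mdist m" by simp
  define M where "M = mtopology_of m"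
  have M: "M = mtopology" by (simp add: M_def mtopology_of_def)
  have topM: "topspace M = mspace m" by (simp add: M_def)
  have cont: "continuous_map M X f" and onto: "f ` mspace m = topspace X"
    and openf: "open_map M X f" and bc: "boundary_compact_map M X f"
    using f by (auto simp: open_boundary_compact_onto_def M_def)
  define Z where "Z = nonisolated_points X"
  have ZX: "Z \<subseteq> topspace X" by (auto simp: Z_def nonisolated_points_def)
  define F where "F y = {z \<in> mspace m. f z = y}" for y
  have F_compact: "compactin mtopology (F y)" if "y \<in> Z" for y
    using bc fibre_eq_frontier[OF X cont openf, of y] that ZX
    unfolding boundary_compact_map_def F_def Z_def topM M[symmetric] by (metis (lifting) subsetD)
  define r where "r n = inverse (real (Suc n))" for n
  have r_pos: "0 < r n" for n by (simp add: r_def)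
  have r_mono: "r n \<le> r k" if "k \<le> n" for k n
    using that by (simp add: r_def inverse_eq_divide frac_le)
  have r_small: "\<exists>n. r n < e" if "0 < e" for e
    using reals_Archimedean[OF that] by (simp add: r_def)
  have "\<exists>K. finite K \<and> K \<subseteq> F y \<and> F y \<subseteq> (\<Union>d\<in>K. mball d (r n))" if "y \<in> Z" for y n
    using compactin_imp_mtotally_bounded[OF F_compact[OF that]] r_pos
    unfolding mtotally_bounded_def by blast
  then obtain D where D: "\<And>y n. y \<in> Z \<Longrightarrow> finite (D y n)" "\<And>y n. y \<in> Z \<Longrightarrow> D y n \<subseteq> F y"
    "\<And>y n. y \<in> Z \<Longrightarrow> F y \<subseteq> (\<Union>d\<in>D y n. mball d (r n))"
    by metis
  \<comment> \<open>The radius is doubled for condition (2): if \<open>z'\<close> in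
    \<open>F y\<close> is within \<open>r n\<close> of \<open>z\<close> and of a net point
    \<open>d\<close>, then \<open>z\<close> lies in the ball of radius \<open>2 * r n\<close> about
    \<open>d\<close>.\<close>
  define L where "L y n = (\<lambda>d. f ` mball d (2 * r n)) ` D y n" for y n
  \<comment> \<open>Condition (2) asks for members of \<open>\<W> y\<close> only at non-isolated
    \<open>y\<close>, so the empty family serves elsewhere.\<close>
  define \<W> where "\<W> y = (if y \<in> Z then \<Union>n. L y n else {})" for y
  have f_ball: "openin X (f ` mball d e)" for d e
    using openf openin_mball unfolding open_map_def M by blast
  \<comment> \<open>A Lebesgue number for the cover of the compact fibre by the single preimage of
    \<open>U\<close>.\<close>
  have cov: "\<exists>e>0. \<forall>z\<in>F y. f ` mball z e \<subseteq> U" if yU: "y \<in> Z" "openin X U" "y \<in> U" for y U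
  proof -
    have "openin mtopology {z \<in> mspace m. f z \<in> U}"
      using openin_continuous_map_preimage[OF cont yU(2)] by (simp add: topM M)
    then obtain e where "e > 0" "\<forall>z\<in>F y. \<exists>V\<in>{{z \<in> mspace m. f z \<in> U}}. mball z e \<subseteq> V"
      using lebesgue_number[OF F_compact[OF yU(1)], of "{{z \<in> mspace m. f z \<in> U}}"] yU(3)
      by (auto simp: F_def)
    then show ?thesis by (intro exI[of _ e]) auto
  qed
  have "open_uniform_G_assignment X \<W>"
    unfolding open_uniform_G_assignment_def
  proof (intro conjI ballI allI impI; (elim conjE)?)
    fix x W assume "x \<in> topspace X" "W \<in> \<W> x"
    then show "openin X W" using f_ball by (auto simp: \<W>_def L_def split: if_splits)
  next
    fix x assume "x \<in> topspace X"
    have "x \<in> f ` mball d (2 * r n)" if "x \<in> Z" "d \<in> D x n" for d n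
      using D(2)[OF that(1)] that r_pos[of n] by (force simp: F_def)
    then show "x \<in> \<Inter>(\<W> x)" by (auto simp: \<W>_def L_def)
    have "countable (L x n)" if "x \<in> Z" for n
      using D(1)[OF that] by (simp add: L_def countable_finite)
    then show "countable (\<W> x)" by (simp add: \<W>_def)
  next
    fix x U assume U: "openin X U" "x \<in> U"
    then have "x \<in> f ` mspace m" using onto openin_subset[OF U(1)] U(2) by auto
    then obtain z where z: "z \<in> mspace m" "f z = x" by blast
    have "openin mtopology {z \<in> mspace m. f z \<in> U}"
      using openin_continuous_map_preimage[OF cont U(1)] by (simp add: topM M)
    moreover have "z \<in> {z \<in> mspace m. f z \<in> U}" using z U(2) by simp
    ultimately obtain e where e: "e > 0" "mball z e \<subseteq> {z \<in> mspace m. f z \<in> U}"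
      by (meson openin_mtopology)
    obtain n where n: "r n < e / 4" using r_small[of "e/4"] e by auto
    show "\<exists>V. openin X V \<and> x \<in> V \<and> (\<forall>y\<in>V \<inter> nonisolated_points X. \<exists>W\<in>\<W> y. x \<in> W \<and> W \<subseteq> U)"
    proof (intro exI conjI ballI)
      show "openin X (f ` mball z (r n))" by (rule f_ball)
      show "x \<in> f ` mball z (r n)" using z r_pos by (intro image_eqI[of _ _ z]) auto
      fix y assume y: "y \<in> f ` mball z (r n) \<inter> nonisolated_points X"
      then have yZ: "y \<in> Z" by (simp add: Z_def)
      from y obtain z' where z': "z' \<in> mball z (r n)" "f z' = y" by blast
      then have "z' \<in> F y" by (simp add: F_def)
      then obtain d where d: "d \<in> D y n" "z' \<in> mball d (r n)"
        using D(3)[OF yZ, of n] by blast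
      have dz: "mdist m d z < 2 * r n"
        using triangle[of d z' z] d z' z commute[of z z'] by (simp add: in_mball)
      have "mball d (2 * r n) \<subseteq> mball z e"
      proof
        fix p assume p: "p \<in> mball d (2 * r n)"
        then have "mdist m z p < 4 * r n"
          using triangle[of z d p] dz z commute[of d z] by (simp add: in_mball)
        then show "p \<in> mball z e" using p n z by (simp add: in_mball)
      qed
      then have "f ` mball d (2 * r n) \<subseteq> U" using e by blast
      moreover have "x \<in> f ` mball d (2 * r n)" using dz d z by (intro image_eqI[of _ _ z]) auto
      moreover have "f ` mball d (2 * r n) \<in> \<W> y"
        using d yZ by (auto simp: \<W>_def L_def)
      ultimately show "\<exists>W\<in>\<W> y. x \<in> W \<and> W \<subseteq> U" by blast
    qed
  next
    fix x \<W>' assume x: "x \<in> topspace X" and sub: "\<W>' \<subseteq> \<W> x" and inf: "infinite \<W>'"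
    have xZ: "x \<in> Z" using sub inf by (cases "x \<in> Z") (auto simp: \<W>_def)
    show "network_at X x \<W>'"
      unfolding network_at_def
    proof (intro allI impI, elim conjE)
      fix U assume U: "openin X U" "x \<in> U"
      obtain e where e: "e > 0" "\<And>z. z \<in> F x \<Longrightarrow> f ` mball z e \<subseteq> U"
        using cov[OF xZ U] by blast
      obtain k where k: "r k < e / 2" using r_small[of "e/2"] e by auto
      \<comment> \<open>Each level is finite, so an infinite subfamily has a member of level at
        least \<open>k\<close>, where the radii are below \<open>e\<close>.\<close>
      have "finite (\<Union>n<k. L x n)" using D(1)[OF xZ] by (auto simp: L_def)
      then obtain W where W: "W \<in> \<W>'" "W \<notin> (\<Union>n<k. L x n)"
        using inf by (meson finite_subset subsetI)
      then obtain n where n: "W \<in> L x n" "k \<le> n"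
        using sub xZ by (fastforce simp: \<W>_def)
      then obtain d where d: "d \<in> D x n" "W = f ` mball d (2 * r n)" by (auto simp: L_def)
      have "2 * r n \<le> e" using r_mono[OF n(2)] k by auto
      then have "mball d (2 * r n) \<subseteq> mball d e" by (auto)
      then have "W \<subseteq> U" using d e(2) D(2)[OF xZ] by blast
      moreover have "x \<in> W"
        using d D(2)[OF xZ] r_pos[of n] by (force simp: F_def)
      ultimately show "\<exists>W\<in>\<W>'. x \<in> W \<and> W \<subseteq> U" using W by blast
    qed
  qed
  then show ?thesis unfolding has_open_uniform_G_at_nonisolated_def by blast
qed

section \<open>Sequences of centres and the fixed assignment\<close>

text \<open>The latest entry comes first, so that one more step of a branch is a
  \<open>Cons\<close>, matching the recursion of \<open>A\<close>.\<close>

definition history :: "(nat \<Rightarrow> 'a) \<Rightarrow> nat \<Rightarrow> 'a list" where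
  "history y n = rev (map y [0..<n])"

lemma history_simps [simp]:
  "history y 0 = []" "history y (Suc n) = y n # history y n"
  "length (history y n) = n" "set (history y n) = y ` {..<n}"
  by (auto simp: history_def)

lemma history_eq_iff: "history y n = history z n \<longleftrightarrow> (\<forall>i<n. y i = z i)"
  by (induction n) (auto simp: less_Suc_eq)

text \<open>\<open>V x U\<close> is a chosen neighbourhood as in condition (2); \<open>le\<close>
  stands for a well-order of the points, given by least elements and antisymmetry.\<close>

locale uniform_G_space =
  fixes X :: "'a topology" and \<W> :: "'a \<Rightarrow> 'a set set" and V :: "'a \<Rightarrow> 'a set \<Rightarrow> 'a set"
    and le :: "'a \<Rightarrow> 'a \<Rightarrow> bool"
  assumes t1: "t1_space X"
    and openin_\<W>: "\<And>x W. x \<in> topspace X \<Longrightarrow> W \<in> \<W> x \<Longrightarrow> openin X W"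
    and mem_\<W>: "\<And>x W. x \<in> topspace X \<Longrightarrow> W \<in> \<W> x \<Longrightarrow> x \<in> W"
    and countable_\<W>: "\<And>x. x \<in> topspace X \<Longrightarrow> countable (\<W> x)"
    and openin_V: "\<And>x U. openin X U \<Longrightarrow> x \<in> U \<Longrightarrow> openin X (V x U)"
    and mem_V: "\<And>x U. openin X U \<Longrightarrow> x \<in> U \<Longrightarrow> x \<in> V x U"
    and V_witness: "\<And>x y U. openin X U \<Longrightarrow> x \<in> U \<Longrightarrow> y \<in> V x U \<Longrightarrow> y \<in> nonisolated_points X
                      \<Longrightarrow> \<exists>W\<in>\<W> y. x \<in> W \<and> W \<subseteq> U"
    and network_\<W>: "\<And>x \<W>'. x \<in> topspace X \<Longrightarrow> \<W>' \<subseteq> \<W> x \<Longrightarrow> infinite \<W>' \<Longrightarrow> network_at X x \<W>'"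
    and least: "\<And>S. S \<noteq> {} \<Longrightarrow> \<exists>a\<in>S. \<forall>b\<in>S. le a b"
    and antisym: "\<And>a b. le a b \<Longrightarrow> le b a \<Longrightarrow> a = b"
begin

abbreviation "Z \<equiv> nonisolated_points X"

lemma Z_topspace: "y \<in> Z \<Longrightarrow> y \<in> topspace X"
  by (simp add: nonisolated_points_def)

lemma isolated_open: "x \<in> topspace X \<Longrightarrow> x \<notin> Z \<Longrightarrow> openin X {x}"
  by (simp add: nonisolated_points_def isolated_points_def)

text \<open>The members not inside \<open>U\<close> cannot form a network at \<open>x\<close>, so
  condition (3) forbids infinitely many. Condition (3) is applied in this form throughout.\<close>

lemma finite_not_subset:
  assumes "x \<in> topspace X" "openin X U" "x \<in> U"
  shows "finite {W \<in> \<W> x. \<not> W \<subseteq> U}"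
proof (rule ccontr)
  assume "infinite {W \<in> \<W> x. \<not> W \<subseteq> U}"
  then have "network_at X x {W \<in> \<W> x. \<not> W \<subseteq> U}"
    using assms(1) by (intro network_\<W>) auto
  then show False using assms unfolding network_at_def by blast
qed

lemma openin_remove: "openin X (topspace X - {x})"
  using t1 by (metis Diff_empty Diff_insert0 closedin_t1_singleton openin_closedin_eq openin_diff openin_topspace)

text \<open>The case of \<open>U\<close> the complement of \<open>p\<close>. It keeps the
  intersection in \<open>G\<close> finite, hence open.\<close>

lemma finite_mem:
  assumes "x \<in> topspace X" "p \<noteq> x"
  shows "finite {W \<in> \<W> x. p \<in> W}"
proof -
  have "finite {W \<in> \<W> x. \<not> W \<subseteq> topspace X - {p}}"
    using assms by (intro finite_not_subset openin_remove) auto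
  then show ?thesis by (rule rev_finite_subset) blast
qed

lemma ex_subset: "x \<in> Z \<Longrightarrow> openin X U \<Longrightarrow> x \<in> U \<Longrightarrow> \<exists>W\<in>\<W> x. W \<subseteq> U"
  using V_witness[OF _ _ mem_V] by blast

section \<open>The tree of open sets\<close>

text \<open>A decreasing countable neighbourhood base at a non-isolated \<open>x\<close>.\<close>

definition B :: "'a \<Rightarrow> nat \<Rightarrow> 'a set" where
  "B x n = (\<Inter>i\<le>n. from_nat_into (\<W> x) i)"

lemma from_\<W>: "x \<in> Z \<Longrightarrow> from_nat_into (\<W> x) i \<in> \<W> x"
  by (rule from_nat_into) (use ex_subset[OF _ openin_topspace Z_topspace] in blast)

lemma mem_B: "x \<in> Z \<Longrightarrow> x \<in> B x n"
  using mem_\<W>[OF Z_topspace from_\<W>] by (simp add: B_def)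

lemma openin_B: "x \<in> Z \<Longrightarrow> openin X (B x n)"
  unfolding B_def using openin_\<W>[OF Z_topspace from_\<W>] by (intro openin_Inter) auto

lemma B_eventually_subset:
  assumes "x \<in> Z" "openin X U" "x \<in> U"
  obtains n where "\<And>k. n \<le> k \<Longrightarrow> B x k \<subseteq> U"
proof -
  obtain W where W: "W \<in> \<W> x" "W \<subseteq> U" using ex_subset[OF assms] by blast
  then obtain n where "from_nat_into (\<W> x) n = W"
    using from_nat_into_surj[OF countable_\<W>[OF Z_topspace[OF assms(1)]]] by blast
  then have "B x k \<subseteq> U" if "n \<le> k" for k using W that by (auto simp: B_def)
  then show ?thesis using that by blast
qed

text \<open>In the next two definitions, \<open>S\<close> is the open set attached to a node, \<open>s\<close> lists the centres on the
  path to it (latest first), and \<open>y\<close> is the centre of a child.\<close>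

definition G :: "'a set \<Rightarrow> 'a list \<Rightarrow> 'a \<Rightarrow> 'a set" where
  "G S s y = S \<inter> B y (length s) \<inter> (topspace X - (set s - {y}))
     \<inter> (topspace X \<inter> \<Inter>(\<Union>z\<in>(set s - {y}) \<inter> Z. {W \<in> \<W> z. y \<in> W}))"

definition H :: "'a set \<Rightarrow> 'a list \<Rightarrow> 'a \<Rightarrow> 'a set" where
  "H S s y = V y (G S s y) \<inter> G S s y"

text \<open>Assigning each point to the least covering set that contains it is the device of Stone's
  proof that metric spaces are paracompact.\<close>

definition first_centre :: "'a set \<Rightarrow> 'a list \<Rightarrow> 'a \<Rightarrow> 'a \<Rightarrow> bool" where
  "first_centre S s x y \<longleftrightarrow> y \<in> Z \<inter> S \<and> x \<in> H S s y \<and> (\<forall>z\<in>Z \<inter> S. x \<in> H S s z \<longrightarrow> le y z)"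

text \<open>The non-isolated points with first centre \<open>y\<close> are fattened by
  \<open>V\<close> to an open set. A point \<open>x\<close> of \<open>V x' (H (A s) s y)\<close>
  with \<open>x\<close> in \<open>Z\<close> has some \<open>W\<close> in \<open>\<W> x\<close> with
  \<open>x'\<close> in \<open>W\<close> and \<open>W\<close> inside \<open>H (A s) s y\<close>,
  which bounds the number of children at \<open>x\<close>. Isolated points become singleton
  children.\<close>

primrec A :: "'a list \<Rightarrow> 'a set" where
  "A [] = topspace X"
| "A (y # s) = (if y \<in> Z
      then H (A s) s y \<inter> (\<Union>x\<in>{x. x \<in> Z \<and> first_centre (A s) s x y}. V x (H (A s) s y))
      else A s \<inter> {y})"

lemma G_props:
  assumes "openin X S" "y \<in> Z \<inter> S"
  shows "openin X (G S s y)" "y \<in> G S s y"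
proof -
  define \<C> where "\<C> = (\<Union>z\<in>(set s - {y}) \<inter> Z. {W \<in> \<W> z. y \<in> W})"
  have "finite {W \<in> \<W> z. y \<in> W}" if "z \<in> (set s - {y}) \<inter> Z" for z
    using that by (intro finite_mem Z_topspace) auto
  \<comment> \<open>\<open>topspace X\<close> keeps the family nonempty when there are no
    constraints.\<close>
  then have "finite (insert (topspace X) \<C>)" unfolding \<C>_def by blast
  moreover have "openin X W" if "W \<in> insert (topspace X) \<C>" for W
    using that openin_\<W> Z_topspace unfolding \<C>_def by blast
  ultimately have \<C>_open: "openin X (\<Inter>(insert (topspace X) \<C>))"
    by (intro openin_Inter) blast+
  have "closedin X (topspace X \<inter> (set s - {y}))"
    using t1 by (simp add: t1_space_closedin_finite)
  then have s_open: "openin X (topspace X - (set s - {y}))"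
    by (metis Diff_Int Diff_cancel Un_empty_left openin_diff openin_topspace)
  have "openin X (S \<inter> B y (length s))"
    using assms openin_B by blast
  from openin_Int[OF openin_Int[OF this s_open] \<C>_open]
  show "openin X (G S s y)" by (simp add: G_def \<C>_def)
  show "y \<in> G S s y" using assms mem_B Z_topspace by (simp add: G_def)
qed

lemma H_props:
  assumes "openin X S" "y \<in> Z \<inter> S"
  shows "openin X (H S s y)" "y \<in> H S s y"
  using G_props[OF assms] openin_V mem_V by (auto simp: H_def)

lemma H_subset_G: "H S s y \<subseteq> G S s y"
  by (simp add: H_def)

lemma A_Cons_subset_H: "y \<in> Z \<Longrightarrow> A (y # s) \<subseteq> H (A s) s y"
  by auto

lemma A_Cons_subset: "A (y # s) \<subseteq> A s"
proof (cases "y \<in> Z")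
  case True
  have "G (A s) s y \<subseteq> A s" by (auto simp: G_def)
  then show ?thesis using A_Cons_subset_H[OF True] H_subset_G by blast
qed simp

lemma openin_A: "openin X (A s)"
proof (induction s)
  case (Cons y s)
  show ?case
  proof (cases "y \<in> Z")
    case True
    have "openin X (H (A s) s y \<inter> V x (H (A s) s y))" if "first_centre (A s) s x y" for x
    proof -
      have "y \<in> Z \<inter> A s" "x \<in> H (A s) s y" using that by (simp_all add: first_centre_def)
      then show ?thesis using H_props(1)[OF Cons] openin_V by blast
    qed
    then have "openin X (\<Union>x\<in>{x. x \<in> Z \<and> first_centre (A s) s x y}. H (A s) s y \<inter> V x (H (A s) s y))"
      by (intro openin_Union) auto
    then show ?thesis using True by simp
  next
    case yZ: False
    show ?thesis
    proof (cases "y \<in> A s")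
      case True
      then have "y \<in> topspace X" using openin_subset[OF Cons] by blast
      then show ?thesis using True yZ isolated_open by simp
    qed (use yZ in simp)
  qed
qed simp

lemma A_topspace: "x \<in> A s \<Longrightarrow> x \<in> topspace X"
  using openin_subset[OF openin_A[of s]] by blast

lemma openin_H_A: "first_centre (A s) s x y \<Longrightarrow> openin X (H (A s) s y)"
  by (rule H_props(1)[OF openin_A]) (simp add: first_centre_def)

section \<open>Children cover a node and are point-finite at non-isolated points\<close>

text \<open>\<open>x\<close> is itself a candidate, lying in \<open>H (A s) s x\<close>, so a least
  candidate exists.\<close>

lemma ex_first_centre:
  assumes "x \<in> Z" "x \<in> A s"
  shows "\<exists>y. first_centre (A s) s x y"
proof -
  have "x \<in> H (A s) s x" using assms by (intro H_props(2)[OF openin_A]) simp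
  then have "{y \<in> Z \<inter> A s. x \<in> H (A s) s y} \<noteq> {}" using assms by blast
  from least[OF this] show ?thesis unfolding first_centre_def by blast
qed

lemma ex_child:
  assumes "x \<in> A s"
  shows "\<exists>y. x \<in> A (y # s)"
proof (cases "x \<in> Z")
  case True
  obtain y where y: "first_centre (A s) s x y"
    using ex_first_centre True assms by blast
  then have "y \<in> Z" and xH: "x \<in> H (A s) s y" by (simp_all add: first_centre_def)
  moreover have "x \<in> V x (H (A s) s y)"
    by (rule mem_V[OF openin_H_A[OF y] xH])
  ultimately have "x \<in> A (y # s)" using y True by auto
  then show ?thesis ..
qed (use assms in auto)

lemma child_centre:
  assumes "x \<in> Z" "x \<in> A (y # s)"
  shows "y \<in> Z" "y \<in> A s" "\<exists>x'. first_centre (A s) s x' y \<and> x \<in> V x' (H (A s) s y)"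
proof -
  show "y \<in> Z" using assms by (cases "y \<in> Z") auto
  then show "\<exists>x'. first_centre (A s) s x' y \<and> x \<in> V x' (H (A s) s y)" using assms by auto
  then show "y \<in> A s" by (auto simp: first_centre_def)
qed

text \<open>The centre \<open>y\<close> of a child containing \<open>x\<close> is the least centre \<open>z\<close> with \<open>W \<subseteq> H S s z\<close>
  for some \<open>W \<in> \<W> x\<close>; all but finitely many \<open>W\<close> yield the first centre of \<open>x\<close>.\<close>

lemma finite_children:
  assumes x: "x \<in> Z"
  shows "finite {y. x \<in> A (y # s)}"
proof (cases "x \<in> A s")
  case False
  then have "{y. x \<in> A (y # s)} = {}" using A_Cons_subset by blast
  then show ?thesis by simp
next
  case True
  define P where "P W y \<longleftrightarrow> y \<in> Z \<inter> A s \<and> W \<subseteq> H (A s) s y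
      \<and> (\<forall>z\<in>Z \<inter> A s. W \<subseteq> H (A s) s z \<longrightarrow> le y z)" for W y
  have P_unique: "y = z" if "P W y" "P W z" for W y z
    using that antisym unfolding P_def by blast
  obtain a where a: "first_centre (A s) s x a"
    using ex_first_centre[OF x True] by blast
  define F where "F = {W \<in> \<W> x. \<not> W \<subseteq> H (A s) s a}"
  have finF: "finite F"
    unfolding F_def using a
    by (intro finite_not_subset[OF Z_topspace[OF x] openin_H_A[OF a]]) (simp add: first_centre_def)
  have "y = a \<or> (\<exists>W\<in>F. P W y)" if y: "x \<in> A (y # s)" for y
  proof -
    obtain x' where x': "first_centre (A s) s x' y" "x \<in> V x' (H (A s) s y)"
      using child_centre(3)[OF x y] by blast
    have "x' \<in> H (A s) s y" using x'(1) by (simp add: first_centre_def)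
    from V_witness[OF openin_H_A[OF x'(1)] this x'(2) x]
    obtain W where W: "W \<in> \<W> x" "x' \<in> W" "W \<subseteq> H (A s) s y" by blast
    \<comment> \<open>If \<open>W\<close> lies in \<open>H (A s) s z\<close>, then so does
      \<open>x'\<close>, whose least centre is \<open>y\<close>.\<close>
    have PW: "P W y" using W x' by (auto simp: P_def first_centre_def)
    show ?thesis
    proof (cases "W \<in> F")
      \<comment> \<open>Now \<open>W\<close> lies in \<open>H (A s) s a\<close>, so
        \<open>le y a\<close> by \<open>P W y\<close>; and \<open>x\<close> in \<open>W\<close> lies
        in \<open>H (A s) s y\<close>, so \<open>le a y\<close>.\<close>
      case False
      then have "le y a" using PW a W by (auto simp: F_def P_def first_centre_def)
      moreover have "le a y"
        using a PW W mem_\<W>[OF Z_topspace[OF x]] by (auto simp: P_def first_centre_def)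
      ultimately show ?thesis using antisym by blast
    qed (use PW in blast)
  qed
  then have "{y. x \<in> A (y # s)} \<subseteq> insert a (\<Union>W\<in>F. {y. P W y})"
    by blast
  moreover have "finite {y. P W y}" for W
  proof (cases "\<exists>y. P W y")
    case True
    then obtain y where "P W y" by blast
    then have "{y. P W y} = {y}" using P_unique by blast
    then show ?thesis by simp
  qed simp
  ultimately show ?thesis using finF by (meson finite.insertI finite_UN_I finite_subset)
qed

declare A.simps(2) [simp del]

section \<open>Convergence of branches\<close>

definition converges :: "(nat \<Rightarrow> 'a) \<Rightarrow> 'a \<Rightarrow> bool" where
  "converges y x \<longleftrightarrow> (\<forall>n. x \<in> A (history y n)) \<and>
     (\<forall>U. openin X U \<and> x \<in> U \<longrightarrow> (\<exists>n. A (history y n) \<subseteq> U))"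

lemma A_history_antimono: "m \<le> n \<Longrightarrow> A (history y n) \<subseteq> A (history y m)"
proof (induction n rule: dec_induct)
  case (step n)
  then show ?case using A_Cons_subset[of "y n" "history y n"] by (simp only: history_simps)
qed simp

lemma converges_unique:
  assumes "converges y x" "converges y x'"
  shows "x = x'"
proof (rule ccontr)
  assume "x \<noteq> x'"
  then have "x \<in> topspace X - {x'}" using assms(1) A_topspace by (auto simp: converges_def)
  then obtain n where "A (history y n) \<subseteq> topspace X - {x'}"
    using assms(1) openin_remove unfolding converges_def by blast
  then show False using assms(2) by (auto simp: converges_def)
qed

text \<open>Each level yields \<open>w n\<close> in \<open>\<W> x\<close> containing
  \<open>y n\<close> and lying in the \<open>G\<close> of that level. If the centres stabilise, the
  factor \<open>B\<close> of \<open>G\<close> shrinks the nodes to the final centre. Otherwise the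
  centres tend to \<open>x\<close> and the last factor of \<open>G\<close> controls the
  nodes.\<close>

lemma branch_converges:
  assumes x: "x \<in> Z" and mem: "\<And>n. x \<in> A (history y n)"
  shows "converges y x"
proof -
  have step: "x \<in> A (y n # history y n)" for n using mem[of "Suc n"] by simp
  have yZ: "y n \<in> Z" and yA: "y n \<in> A (history y n)" for n
    using child_centre(1,2)[OF x step] by blast+
  have A_G: "A (history y (Suc n)) \<subseteq> G (A (history y n)) (history y n) (y n)" for n
    using A_Cons_subset_H[OF yZ] H_subset_G by fastforce
  have "\<exists>W\<in>\<W> x. y n \<in> W \<and> W \<subseteq> G (A (history y n)) (history y n) (y n)" for n
  proof (rule V_witness)
    show "x \<in> V (y n) (G (A (history y n)) (history y n) (y n))"
      using A_Cons_subset_H[OF yZ] step by (fastforce simp: H_def)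
  qed (use x G_props[OF openin_A] yZ yA in auto)
  then obtain w where w: "\<And>n. w n \<in> \<W> x" "\<And>n. y n \<in> w n"
      "\<And>n. w n \<subseteq> G (A (history y n)) (history y n) (y n)"
    by metis
  have "\<exists>n. A (history y n) \<subseteq> U" if U: "openin X U" "x \<in> U" for U
  proof (cases "\<exists>N. \<forall>n\<ge>N. y n = y N")
    case True
    then obtain N where N: "\<And>n. N \<le> n \<Longrightarrow> y n = y N" by blast
    have A_B: "A (history y (Suc n)) \<subseteq> B (y N) n" if "N \<le> n" for n
      using A_G[of n] N[OF that] by (auto simp: G_def)
    \<comment> \<open>\<open>x\<close> lies in \<open>B (y N) n\<close> for all large
      \<open>n\<close>, while these sets eventually avoid any point other than
      \<open>y N\<close>.\<close>
    have "x = y N"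
    proof (rule ccontr)
      assume "x \<noteq> y N"
      then obtain k where k: "\<And>n. k \<le> n \<Longrightarrow> B (y N) n \<subseteq> topspace X - {x}"
        using B_eventually_subset[OF yZ openin_remove[of x], of N] Z_topspace[OF yZ] by blast
      have "x \<in> B (y N) (max N k)"
        using A_B[of "max N k"] mem[of "Suc (max N k)"] by (meson max.cobounded1 subsetD)
      then show False using k[of "max N k"] by auto
    qed
    then obtain k where "\<And>n. k \<le> n \<Longrightarrow> B (y N) n \<subseteq> U"
      using B_eventually_subset[OF yZ U(1), of N] U(2) by blast
    then show ?thesis using A_B[of "max N k"] by (meson max.cobounded1 max.cobounded2 order_trans)
  next
    case False
    txt \<open>A centre that has been left never returns, since later neighbourhoods avoid it.\<close>
    have leave: "\<exists>m>n. \<forall>k\<ge>m. y k \<noteq> y n" for n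
    proof -
      obtain m where m: "n \<le> m" "y m \<noteq> y n" using False by blast
      then have "n < m" by (cases "n = m") auto
      moreover have "y k \<noteq> y n" if "m \<le> k" for k
      proof (cases "k = m")
        case False
        then have "y k \<in> A (history y (Suc m))"
          using yA A_history_antimono[of "Suc m" k y] that by auto
        then show ?thesis using A_G[of m] m \<open>n < m\<close> by (auto simp: G_def)
      qed (use m in simp)
      ultimately show ?thesis by blast
    qed
    \<comment> \<open>\<open>w n\<close> contains \<open>y n\<close>, whereas \<open>w k\<close>
      avoids \<open>y n\<close> once the branch has left that centre for good.\<close>
    have fin_w: "finite {n. w n = W}" for W
    proof (cases "\<exists>n. w n = W")
      case True
      then obtain n where n: "w n = W" by blast
      obtain m where m: "m > n" "\<forall>k\<ge>m. y k \<noteq> y n" using leave by blast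
      have "w k \<noteq> W" if "m \<le> k" for k
      proof -
        have "y n \<notin> w k" using w(3)[of k] m that by (fastforce simp: G_def)
        then show ?thesis using w(2) n by blast
      qed
      then have "{n. w n = W} \<subseteq> {..<m}" by (auto simp: not_less[symmetric])
      then show ?thesis using finite_subset by blast
    qed auto
    \<comment> \<open>All but finitely many members of \<open>\<W> x\<close> lie in
      \<open>U'\<close>, and each of the others is \<open>w n\<close> for finitely many
      \<open>n\<close> only.\<close>
    have lim: "\<exists>N. \<forall>n\<ge>N. y n \<in> U'" if "openin X U'" "x \<in> U'" for U'
    proof -
      have "finite (\<Union>W\<in>{W \<in> \<W> x. \<not> W \<subseteq> U'}. {n. w n = W})"
        using finite_not_subset[OF Z_topspace[OF x] that] fin_w by blast
      then have "finite {n. \<not> w n \<subseteq> U'}"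
        by (rule rev_finite_subset) (use w(1) in auto)
      then obtain N where "\<forall>n\<in>{n. \<not> w n \<subseteq> U'}. n < N"
        using finite_nat_set_iff_bounded by blast
      then show ?thesis using w(2) by (intro exI[of _ N]) (force simp: not_less[symmetric])
    qed
    txt \<open>The centres converge to \<open>x\<close>. To bound a node, and not only its centre, use that \<open>G\<close> lies in
      every \<open>W\<close> attached to an earlier centre and containing the present one.\<close>
    obtain N where N: "y N \<in> V x U"
      using lim[OF openin_V[OF U] mem_V[OF U]] by blast
    obtain W where W: "W \<in> \<W> (y N)" "x \<in> W" "W \<subseteq> U"
      using V_witness[OF U N yZ] by blast
    obtain k where k: "\<forall>n\<ge>k. y n \<in> W"
      using lim[OF openin_\<W>[OF Z_topspace[OF yZ] W(1)] W(2)] by blast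
    obtain m where m: "m > N" "\<forall>k\<ge>m. y k \<noteq> y N" using leave by blast
    \<comment> \<open>Beyond \<open>m\<close>, so that \<open>y N\<close> counts among the other
      earlier centres; beyond \<open>k\<close>, so that \<open>W\<close> contains
      \<open>y n\<close>.\<close>
    define n where "n = max m k"
    have "m \<le> n" "k \<le> n" by (simp_all add: n_def)
    then have "y n \<noteq> y N" "N < n" "y n \<in> W" using m k by auto
    then have "y N \<in> (set (history y n) - {y n}) \<inter> Z" "y n \<in> W"
      using yZ by auto
    then have "G (A (history y n)) (history y n) (y n) \<subseteq> W"
      using W(1) unfolding G_def by blast
    then show ?thesis using A_G[of n] W(3) by blast
  qed
  then show ?thesis using mem by (auto simp: converges_def)
qed

text \<open>Once \<open>x\<close> has been chosen as a centre, the next node is inside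
  \<open>{x}\<close>.\<close>

lemma isolated_branch_converges:
  assumes x: "x \<notin> Z" and mem: "\<And>n. x \<in> A (history y n)" and "y n = x"
  shows "converges y x"
proof -
  have "A (history y (Suc n)) \<subseteq> {x}" using x \<open>y n = x\<close> by (simp add: A.simps)
  then have "\<exists>k. A (history y k) \<subseteq> U" if "x \<in> U" for U
    using that by blast
  then show ?thesis using mem by (simp add: converges_def)
qed

text \<open>Children cover their node, so a branch can follow \<open>x\<close> forever. This gives
  both surjectivity and openness of the limit map.\<close>

lemma ex_converging_extension:
  assumes x: "x \<in> A (history y n)"
  shows "\<exists>y'. history y' n = history y n \<and> converges y' x"
proof -
  \<comment> \<open>An isolated \<open>x\<close> has to be its own centre for
    \<open>isolated_branch_converges\<close> to apply.\<close>
  define c where "c s = (if x \<in> Z then (SOME z. x \<in> A (z # s)) else x)" for s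
  have c: "x \<in> A (c s # s)" if "x \<in> A s" for s
    using someI_ex[OF ex_child[OF that]] that by (cases "x \<in> Z") (simp_all add: c_def A.simps(2)[of x])
  define h where "h k = ((\<lambda>s. c s # s) ^^ k) (history y n)" for k
  define y' where "y' i = (if i < n then y i else c (h (i - n)))" for i
  have y'_n: "history y' n = history y n" by (simp add: history_eq_iff y'_def)
  have h_simps: "h 0 = history y n" "h (Suc k) = c (h k) # h k" for k
    by (simp_all add: h_def)
  have "y' (n + k) = c (h k)" for k by (simp add: y'_def)
  then have hist: "history y' (n + k) = h k" for k
    by (induction k) (simp_all add: y'_n h_simps)
  have mem_h: "x \<in> A (h k)" for k
    by (induction k) (use x c in \<open>simp_all add: h_simps\<close>)
  have mem: "x \<in> A (history y' i)" for i
    using mem_h[of i] A_history_antimono[of i "n + i" y'] hist[of i] by auto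
  have "converges y' x"
  proof (cases "x \<in> Z")
    case False
    then have "y' n = x" by (simp add: y'_def c_def)
    then show ?thesis using isolated_branch_converges False mem by blast
  qed (use branch_converges mem in blast)
  then show ?thesis using y'_n by blast
qed

text \<open>Centres are recorded as singletons because the metric space is required to live in
  \<^typ>\<open>nat \<Rightarrow> 'a set\<close>.\<close>

definition centre :: "(nat \<Rightarrow> 'a set) \<Rightarrow> nat \<Rightarrow> 'a" where
  "centre c n = the_elem (c n)"

section \<open>The space of branches and its limit map\<close>

definition branches :: "(nat \<Rightarrow> 'a set) set" where
  "branches = {c. (\<forall>n. is_singleton (c n)) \<and> (\<exists>x. converges (centre c) x)}"

definition limit :: "(nat \<Rightarrow> 'a set) \<Rightarrow> 'a" where
  "limit c = (THE x. converges (centre c) x)"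

text \<open>A countable product of discrete spaces, hence metrizable; fixing finitely many
  coordinates gives a neighbourhood base.\<close>

abbreviation Seq :: "(nat \<Rightarrow> 'a set) topology" where
  "Seq \<equiv> product_topology (\<lambda>_. discrete_topology UNIV) UNIV"

lemma limit_eq: "converges (centre c) x \<Longrightarrow> limit c = x"
  unfolding limit_def using converges_unique by blast

lemma converges_limit: "c \<in> branches \<Longrightarrow> converges (centre c) (limit c)"
  unfolding branches_def using limit_eq by auto

lemma limit_in_A: "c \<in> branches \<Longrightarrow> limit c \<in> A (history (centre c) n)"
  using converges_limit by (simp add: converges_def)

lemma openin_coordinate: "openin Seq {c. P (c n)}"
proof -
  have "openin Seq {c \<in> topspace Seq. c n \<in> {a. P a}}"
    by (rule openin_continuous_map_preimage[OF continuous_map_product_projection]) auto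
  then show ?thesis by simp
qed

lemma openin_history: "openin Seq {c. P (history (centre c) n)}"
proof -
  have single: "openin Seq {c. history (centre c) n = s}" for s
  proof (induction n arbitrary: s)
    case 0
    show ?case by (cases "s = []") (use openin_topspace[of Seq] in auto)
  next
    case (Suc n)
    show ?case
    proof (cases s)
      case (Cons a t)
      have "{c. history (centre c) (Suc n) = s} = {c. the_elem (c n) = a} \<inter> {c. history (centre c) n = t}"
        by (auto simp: Cons centre_def)
      then show ?thesis using Suc openin_coordinate[of "\<lambda>b. the_elem b = a"] by auto
    qed simp
  qed
  have "{c. P (history (centre c) n)} = (\<Union>s\<in>Collect P. {c. history (centre c) n = s})" by auto
  then show ?thesis using single by auto
qed

lemma closedin_history: "closedin Seq {c. P (history (centre c) n)}"
proof -
  have "topspace Seq - {c. P (history (centre c) n)} = {c. \<not> P (history (centre c) n)}" by auto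
  then show ?thesis using openin_history[of "\<lambda>s. \<not> P s"] by (simp add: closedin_def)
qed

text \<open>The limit lies in an open \<open>U\<close> iff some node of the branch is inside
  \<open>U\<close>, and a node depends on finitely many coordinates.\<close>

lemma continuous_limit: "continuous_map (subtopology Seq branches) X limit"
  unfolding continuous_map_def
proof (intro conjI allI impI)
  show "limit \<in> topspace (subtopology Seq branches) \<rightarrow> topspace X"
    using limit_in_A A_topspace by auto
  fix U assume U: "openin X U"
  have "{c \<in> branches. limit c \<in> U} = branches \<inter> (\<Union>n. {c. A (history (centre c) n) \<subseteq> U})"
    using converges_limit U limit_in_A by (fastforce simp: converges_def)
  moreover have "openin Seq (\<Union>n. {c. A (history (centre c) n) \<subseteq> U})"
    using openin_history[of "\<lambda>s. A s \<subseteq> U"] by blast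
  ultimately show "openin (subtopology Seq branches) {c \<in> topspace (subtopology Seq branches). limit c \<in> U}"
    by (auto simp: openin_subtopology)
qed

text \<open>A point of the node is the limit of a branch with the same first \<open>n\<close>
  centres. As coordinates are singletons, equal centres mean equal coordinates.\<close>

lemma limit_image_cylinder:
  assumes c: "c \<in> branches"
  shows "A (history (centre c) n) \<subseteq> limit ` {d \<in> branches. \<forall>i<n. d i = c i}"
proof
  fix x assume "x \<in> A (history (centre c) n)"
  then obtain y where y: "history y n = history (centre c) n" "converges y x"
    using ex_converging_extension by blast
  define d where "d i = {y i}" for i
  have centre_d: "centre d = y" by (simp add: centre_def d_def fun_eq_iff)
  then have "d \<in> branches" using y by (auto simp: branches_def d_def)
  moreover have "d i = c i" if "i < n" for i
  proof -
    have "c i = {centre c i}" using c by (auto simp: branches_def centre_def is_singleton_the_elem)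
    then show ?thesis using y(1) that by (auto simp: history_eq_iff d_def)
  qed
  moreover have "limit d = x" using limit_eq y centre_d by simp
  ultimately show "x \<in> limit ` {d \<in> branches. \<forall>i<n. d i = c i}" by blast
qed

lemma limit_onto: "limit ` branches = topspace X"
proof
  show "limit ` branches \<subseteq> topspace X" using limit_in_A A_topspace by blast
  show "topspace X \<subseteq> limit ` branches"
  proof
    fix x assume "x \<in> topspace X"
    \<comment> \<open>Every point lies in the root; a history of length 0 ignores its sequence,
      hence \<open>undefined\<close>.\<close>
    then obtain y where y: "converges y x"
      using ex_converging_extension[of x undefined 0] by auto
    have "centre (\<lambda>i. {y i}) = y" by (simp add: centre_def fun_eq_iff)
    then have "(\<lambda>i. {y i}) \<in> branches" "limit (\<lambda>i. {y i}) = x"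
      using y limit_eq by (auto simp: branches_def)
    then show "x \<in> limit ` branches" by blast
  qed
qed

lemma Seq_cylinder_nhd:
  assumes "openin Seq T" "c \<in> T"
  shows "\<exists>n. {d. \<forall>i<n. d i = c i} \<subseteq> T"
proof -
  obtain U where U: "finite {i. U i \<noteq> UNIV}" "c \<in> Pi\<^sub>E UNIV U" "Pi\<^sub>E UNIV U \<subseteq> T"
    using assms by (auto simp: openin_product_topology_alt)
  obtain n where n: "\<forall>i\<in>{i. U i \<noteq> UNIV}. i < n"
    using U(1) finite_nat_set_iff_bounded by blast
  have "d \<in> Pi\<^sub>E UNIV U" if d: "\<forall>i<n. d i = c i" for d
  proof -
    have "d i \<in> U i" for i
      using n d U(2) by (cases "i < n") auto
    then show ?thesis by auto
  qed
  then have "{d. \<forall>i<n. d i = c i} \<subseteq> Pi\<^sub>E UNIV U" by (simp add: subset_iff)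
  then show ?thesis using U(3) by (meson order_trans)
qed

lemma open_limit: "open_map (subtopology Seq branches) X limit"
  unfolding open_map_def
proof (intro allI impI)
  fix T assume "openin (subtopology Seq branches) T"
  then obtain T' where T': "openin Seq T'" "T = T' \<inter> branches" by (auto simp: openin_subtopology)
  show "openin X (limit ` T)"
  proof (subst openin_subopen, intro ballI)
    fix x assume "x \<in> limit ` T"
    then obtain c where c: "c \<in> T'" "c \<in> branches" "x = limit c" using T' by blast
    obtain n where n: "{d. \<forall>i<n. d i = c i} \<subseteq> T'" using Seq_cylinder_nhd T'(1) c(1) by blast
    have "A (history (centre c) n) \<subseteq> limit ` T"
      using limit_image_cylinder[OF c(2), of n] n T'(2) by blast
    moreover have "x \<in> A (history (centre c) n)" using limit_in_A[OF c(2)] c(3) by simp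
    ultimately show "\<exists>S. openin X S \<and> x \<in> S \<and> S \<subseteq> limit ` T"
      using openin_A by meson
  qed
qed

section \<open>Compact fibres and boundaries\<close>

lemma finite_nodes:
  assumes x: "x \<in> Z"
  shows "finite {s. length s = n \<and> x \<in> A s}"
proof (induction n)
  case (Suc n)
  have "{s. length s = Suc n \<and> x \<in> A s}
      \<subseteq> (\<Union>t\<in>{s. length s = n \<and> x \<in> A s}. (\<lambda>y. y # t) ` {y. x \<in> A (y # t)})"
  proof
    fix s assume s: "s \<in> {s. length s = Suc n \<and> x \<in> A s}"
    then obtain y t where "s = y # t" "length t = n" by (auto simp: length_Suc_conv)
    then show "s \<in> (\<Union>t\<in>{s. length s = n \<and> x \<in> A s}. (\<lambda>y. y # t) ` {y. x \<in> A (y # t)})"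
      using s A_Cons_subset by blast
  qed
  moreover have "finite (\<Union>t\<in>{s. length s = n \<and> x \<in> A s}. (\<lambda>y. y # t) ` {y. x \<in> A (y # t)})"
    using Suc finite_children[OF x] by blast
  ultimately show ?case by (rule finite_subset)
next
  case 0
  have "{s. length s = 0 \<and> x \<in> A s} \<subseteq> {[]}" by auto
  then show ?case by (rule finite_subset) simp
qed

text \<open>By \<open>branch_converges\<close>, the fibre is cut out of a compact product of finite
  sets by the closed conditions that every node contains \<open>x\<close>.\<close>

lemma compactin_fibre:
  assumes x: "x \<in> Z"
  shows "compactin (subtopology Seq branches) {c \<in> branches. limit c = x}" (is "compactin _ ?F")
proof -
  \<comment> \<open>The head of a node of length \<open>Suc n\<close> is its latest centre, the one
    of index \<open>n\<close>.\<close>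
  define K where "K n = (\<lambda>s. {hd s}) ` {s. length s = Suc n \<and> x \<in> A s}" for n
  have "compactin Seq (Pi\<^sub>E UNIV K)"
    using finite_nodes[OF x] by (auto simp: compactin_PiE compactin_discrete_topology K_def)
  moreover have F: "?F = Pi\<^sub>E UNIV K \<inter> (\<Inter>n. {c. x \<in> A (history (centre c) n)})"
  proof (intro equalityI subsetI)
    fix c assume "c \<in> ?F"
    then have c: "c \<in> branches" "limit c = x" by auto
    have mem: "x \<in> A (history (centre c) n)" for n using limit_in_A[OF c(1), of n] c(2) by simp
    have "c n \<in> K n" for n
    proof -
      have "c n = {hd (history (centre c) (Suc n))}"
        using c by (auto simp: branches_def centre_def is_singleton_the_elem)
      moreover have "history (centre c) (Suc n) \<in> {s. length s = Suc n \<and> x \<in> A s}"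
        using mem[of "Suc n"] by simp
      ultimately show ?thesis unfolding K_def by (rule image_eqI)
    qed
    then show "c \<in> Pi\<^sub>E UNIV K \<inter> (\<Inter>n. {c. x \<in> A (history (centre c) n)})" using mem by auto
  next
    fix c assume "c \<in> Pi\<^sub>E UNIV K \<inter> (\<Inter>n. {c. x \<in> A (history (centre c) n)})"
    then have c: "\<And>n. c n \<in> K n" "\<And>n. x \<in> A (history (centre c) n)" by auto
    have "converges (centre c) x" using branch_converges x c(2) by blast
    moreover have "is_singleton (c n)" for n using c(1)[of n] by (auto simp: K_def)
    ultimately show "c \<in> ?F" using limit_eq by (auto simp: branches_def)
  qed
  moreover have "closedin Seq (\<Inter>n. {c. x \<in> A (history (centre c) n)})"
    using closedin_history[of "\<lambda>s. x \<in> A s"] by (intro closedin_Inter) auto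
  ultimately have "compactin Seq ?F"
    by (metis (no_types, lifting) compact_Int_closedin)
  then show ?thesis by (auto simp: compactin_subtopology)
qed

text \<open>Over an isolated point the fibre is clopen, so its boundary is empty; over the others
  the boundary is the compact fibre.\<close>

lemma boundary_compact_limit: "boundary_compact_map (subtopology Seq branches) X limit"
  unfolding boundary_compact_map_def
proof
  fix x assume x: "x \<in> topspace X"
  let ?F = "{c \<in> topspace (subtopology Seq branches). limit c = x}"
  show "compactin (subtopology Seq branches) (subtopology Seq branches frontier_of ?F)"
  proof (cases "x \<in> Z")
    case True
    then show ?thesis
      using fibre_eq_frontier[OF t1 continuous_limit open_limit True] compactin_fibre by simp
  next
    case False
    have "openin (subtopology Seq branches) {c \<in> topspace (subtopology Seq branches). limit c \<in> {x}}"
      using openin_continuous_map_preimage[OF continuous_limit isolated_open[OF x False]] .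
    moreover have "closedin (subtopology Seq branches) {c \<in> topspace (subtopology Seq branches). limit c \<in> {x}}"
      using x t1 by (intro closedin_continuous_map_preimage[OF continuous_limit]) (simp add: closedin_t1_singleton)
    ultimately have "subtopology Seq branches frontier_of ?F = {}"
      by (simp add: frontier_of_def closure_of_closedin interior_of_openin)
    then show ?thesis by simp
  qed
qed

lemma open_boundary_compact_image:
  "\<exists>(m :: (nat \<Rightarrow> 'a set) metric) f. open_boundary_compact_onto (mtopology_of m) X f"
proof -
  have "metrizable_space Seq"
    by (simp add: metrizable_space_product_topology)
  then obtain S d where "Metric_space S d" and Seq: "Seq = Metric_space.mtopology S d"
    unfolding metrizable_space_def by blast
  then have "mtopology_of (metric (S, d)) = Seq"
    by (simp add: Metric_space.mtopology_of)
  then have "mtopology_of (submetric (metric (S, d)) branches) = subtopology Seq branches"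
    by (simp add: mtopology_of_submetric)
  then have "open_boundary_compact_onto (mtopology_of (submetric (metric (S, d)) branches)) X limit"
    using continuous_limit open_limit boundary_compact_limit limit_onto
    by (simp add: open_boundary_compact_onto_def)
  then show ?thesis by blast
qed

end

section \<open>Choice of neighbourhoods and well-order, and the equivalence\<close>

lemma open_uniform_G_imp_open_boundary_compact_image:
  fixes X :: "'a topology"
  assumes X: "t1_space X" and G: "has_open_uniform_G_at_nonisolated X"
  shows "\<exists>(m :: (nat \<Rightarrow> 'a set) metric) f. open_boundary_compact_onto (mtopology_of m) X f"
proof -
  obtain \<W> where \<W>: "open_uniform_G_assignment X \<W>"
    using G unfolding has_open_uniform_G_at_nonisolated_def by blast
  note parts = \<W>[unfolded open_uniform_G_assignment_def]
  define V where "V x U = (SOME V. openin X V \<and> x \<in> V \<and>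
      (\<forall>y \<in> V \<inter> nonisolated_points X. \<exists>W\<in>\<W> y. x \<in> W \<and> W \<subseteq> U))" for x U
  have V: "openin X (V x U) \<and> x \<in> V x U \<and>
      (\<forall>y \<in> V x U \<inter> nonisolated_points X. \<exists>W\<in>\<W> y. x \<in> W \<and> W \<subseteq> U)"
    if "openin X U" "x \<in> U" for x U
  proof -
    from parts[THEN conjunct2, THEN conjunct2, THEN conjunct1] that
    have "\<exists>V. openin X V \<and> x \<in> V \<and>
      (\<forall>y \<in> V \<inter> nonisolated_points X. \<exists>W\<in>\<W> y. x \<in> W \<and> W \<subseteq> U)"
      by meson
    from someI_ex[OF this] show ?thesis unfolding V_def .
  qed
  obtain r :: "'a rel" where r: "Well_order r" "Field r = UNIV"
    using well_ordering[where 'a = 'a] by (elim exE conjE)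
  interpret uniform_G_space X \<W> V "\<lambda>a b. (a, b) \<in> r"
  proof
    show "t1_space X" by (rule X)
    show "openin X W" if "x \<in> topspace X" "W \<in> \<W> x" for x W
      using parts[THEN conjunct1] that by blast
    show "x \<in> W" if "x \<in> topspace X" "W \<in> \<W> x" for x W
      using parts[THEN conjunct2, THEN conjunct1] that by blast
    show "countable (\<W> x)" if "x \<in> topspace X" for x
      using parts[THEN conjunct2, THEN conjunct1] that by blast
    show "network_at X x \<W>'" if "x \<in> topspace X" "\<W>' \<subseteq> \<W> x" "infinite \<W>'" for x \<W>'
      using parts[THEN conjunct2, THEN conjunct2, THEN conjunct2] that by blast
    show "openin X (V x U)" "x \<in> V x U" if "openin X U" "x \<in> U" for x U
      using V[OF that] by blast+
    show "\<exists>W\<in>\<W> y. x \<in> W \<and> W \<subseteq> U"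
      if "openin X U" "x \<in> U" "y \<in> V x U" "y \<in> nonisolated_points X" for x y U
      using V[OF that(1,2)] that(3,4) by blast
    show "\<exists>a\<in>S. \<forall>b\<in>S. (a, b) \<in> r" if "S \<noteq> {}" for S
      using that r Linear_order_Well_order_iff[of r] by (auto simp: well_order_on_def)
    show "a = b" if "(a, b) \<in> r" "(b, a) \<in> r" for a b
      using that r by (auto simp: order_on_defs dest: antisymD)
  qed
  show ?thesis by (rule open_boundary_compact_image)
qed

theorem mainTheorem2:
  fixes X :: "'a topology"
  assumes "Hausdorff_space X"
  shows "(has_open_uniform_G_at_nonisolated X \<longleftrightarrow>
            (\<exists>(m :: (nat \<Rightarrow> 'a set) metric) f. open_boundary_compact_onto (mtopology_of m) X f)) \<and>
         ((\<exists>(m :: 'm metric) f. open_boundary_compact_onto (mtopology_of m) X f) \<longrightarrow>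
            has_open_uniform_G_at_nonisolated X)"
proof (intro conjI iffI impI)
  have t1: "t1_space X" using assms by (rule Hausdorff_imp_t1_space)
  show "\<exists>(m :: (nat \<Rightarrow> 'a set) metric) f. open_boundary_compact_onto (mtopology_of m) X f"
    if "has_open_uniform_G_at_nonisolated X"
    using t1 that by (rule open_uniform_G_imp_open_boundary_compact_image)
  show "has_open_uniform_G_at_nonisolated X"
    if "\<exists>(m :: (nat \<Rightarrow> 'a set) metric) f. open_boundary_compact_onto (mtopology_of m) X f"
    using that open_boundary_compact_image_imp_open_uniform_G[OF t1] by (elim exE)
  show "has_open_uniform_G_at_nonisolated X"
    if "\<exists>(m :: 'm metric) f. open_boundary_compact_onto (mtopology_of m) X f"
    using that open_boundary_compact_image_imp_open_uniform_G[OF t1] by (elim exE)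
qed

end
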